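(* The set of pairs $(\alpha,\beta)\in\mathbb{R}^2$ for which there exist a constant $c>0$ and an integer $N$ such that $$\max\{2,xy\}\cdot\|x\alpha+y\beta\|\cdot\bigl(\log\max\{2,xy\}\bigr)^2\ge c$$ for all positive integers $x,y$ with $xy\ge N$, has Hausdorff dimension $2$.
   Context: For a real number $x$, $\|x\|$ denotes the distance from $x$ to the nearest integer. *)

theory Defs
  imports "HOL-Analysis.Analysis"
begin

definition nint_dist :: "real \<Rightarrow> real" where
  "nint_dist t = \<bar>t - of_int (round t)\<bar>"

(* contribution of a covering set U to the s-dimensional Hausdorff sum,
   with the usual conventions diam(emptyset)^s = 0 and diam(U)^0 = 1 for U nonempty *)
definition hcost :: "real \<Rightarrow> 'a::metric_space set \<Rightarrow> ennreal" where
  "hcost s U = (if U = {} then 0 else if s = 0 then 1 else ennreal (diameter U powr s))"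

definition hausdorff_pre :: "real \<Rightarrow> real \<Rightarrow> 'a::metric_space set \<Rightarrow> ennreal" where
  "hausdorff_pre s \<delta> A =
     (INF U \<in> {U :: nat \<Rightarrow> 'a set. A \<subseteq> (\<Union>i. U i) \<and> (\<forall>i. bounded (U i) \<and> diameter (U i) \<le> \<delta>)}.
        (\<Sum>i. hcost s (U i)))"

definition hausdorff_measure :: "real \<Rightarrow> 'a::metric_space set \<Rightarrow> ennreal" where
  "hausdorff_measure s A = (SUP \<delta> \<in> {0<..}. hausdorff_pre s \<delta> A)"

(* Hausdorff dimension: inf { s >= 0 : H^s(A) = 0 } (value in ereal, infinity if no such s) *)
definition hausdorff_dim :: "'a::metric_space set \<Rightarrow> ereal" where
  "hausdorff_dim A = (INF s \<in> {s. 0 \<le> s \<and> hausdorff_measure s A = 0}. ereal s)"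

end

theory Submission
  imports Defs
begin

text \<open>
  Let \<open>0 \<le> s < 2\<close> and suppose that the set had \<open>s\<close>-dimensional measure zero, so that it has a cover by
  sets \<open>U\<^sub>i\<close> of diameter at most \<open>d\<^sub>i\<close> with \<open>\<Sum>d\<^sub>i\<^sup>s\<close> as small as we like. A Peres--Schlag argument
  produces a point of the set outside all \<open>U\<^sub>i\<close>, as the intersection of nested dyadic squares of
  levels \<open>e, 8e, 64e, \<dots>\<close> (side \<open>2\<^sup>-\<^sup>e\<close> and so on).

  The strips \<open>\<bar>x\<alpha> + y\<beta> - p\<bar> < c / (x y e\<^sup>2)\<close> with \<open>4\<^sup>e \<le> x y < 4\<^sup>8\<^sup>e\<close> are equidistributed in every square of
  level \<open>e\<close>, because \<open>max x y \<ge> 2\<^sup>e\<close>, and thicker than the squares of level \<open>64e\<close>. The squares of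
  level \<open>64e\<close> that they meet are therefore at most a proportion
  \<open>O(c e\<^sup>-\<^sup>2 (\<Sum>1/x)\<^sup>2) = O(c)\<close> of all those inside a square of level \<open>e\<close>, both sums of \<open>1/x\<close> being
  \<open>O(e)\<close>. Hence most subsquares of level \<open>8e\<close> still contain few squares of level \<open>64e\<close> that meet such a
  strip. Since \<open>s < 2\<close>, most of these subsquares are also met by only a small part of the cover,
  measured relative to their size. A subsquare with both properties can be chosen at each step.
\<close>

section \<open>Dyadic squares\<close>

definition cell :: "nat \<Rightarrow> int \<times> int \<Rightarrow> (real \<times> real) set" where
  "cell e Q = {of_int (fst Q) / 2 ^ e .. (of_int (fst Q) + 1) / 2 ^ e}
            \<times> {of_int (snd Q) / 2 ^ e .. (of_int (snd Q) + 1) / 2 ^ e}"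

text \<open>The index ranges are half-open, so a square of level \<open>e'\<close> is listed under
  only one square of level \<open>e\<close>, although the closed squares share edges. Counting is
  therefore exact.\<close>

definition subcells :: "nat \<Rightarrow> nat \<Rightarrow> int \<times> int \<Rightarrow> (int \<times> int) set" where
  "subcells e e' Q = {fst Q * 2 ^ (e' - e) ..< (fst Q + 1) * 2 ^ (e' - e)}
                   \<times> {snd Q * 2 ^ (e' - e) ..< (snd Q + 1) * 2 ^ (e' - e)}"

lemma finite_subcells: "finite (subcells e e' Q)"
  by (simp add: subcells_def)

lemma card_subcells: "card (subcells e e' Q) = 4 ^ (e' - e)"
proof -
  have "card {m * 2 ^ n ..< (m + 1) * 2 ^ n} = 2 ^ n" for m :: int and n :: nat
    by (simp add: algebra_simps nat_power_eq)
  then have "card (subcells e e' Q) = 2 ^ (e' - e) * 2 ^ (e' - e)"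
    by (simp only: subcells_def card_cartesian_product)
  then show ?thesis by (simp flip: power_mult_distrib)
qed

lemma compact_cell: "compact (cell e Q)"
  by (simp add: cell_def compact_Times)

lemma cell_nonempty: "cell e Q \<noteq> {}"
  by (simp add: cell_def divide_right_mono)

lemma dyadic_subinterval:
  fixes a a' :: int
  assumes "e \<le> e'" and "a' \<in> {a * 2 ^ (e' - e) ..< (a + 1) * 2 ^ (e' - e)}"
  shows "{of_int a' / 2 ^ e' .. (of_int a' + 1) / 2 ^ e'}
       \<subseteq> {of_int a / 2 ^ e .. (of_int a + 1) / 2 ^ e :: real}"
proof -
  have split: "(2::real) ^ e' = 2 ^ e * 2 ^ (e' - e)"
    using assms(1) by (simp flip: power_add)
  have "a * 2 ^ (e' - e) \<le> a'" "a' + 1 \<le> (a + 1) * 2 ^ (e' - e)"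
    using assms(2) by auto
  then have "real_of_int (a * 2 ^ (e' - e)) \<le> of_int a'"
       "real_of_int (a' + 1) \<le> of_int ((a + 1) * 2 ^ (e' - e))"
    by (simp_all only: of_int_le_iff)
  then have "real_of_int a * 2 ^ (e' - e) \<le> of_int a'"
       "real_of_int a' + 1 \<le> (of_int a + 1) * 2 ^ (e' - e)"
    by simp_all
  then have "real_of_int a * 2 ^ (e' - e) / 2 ^ e' \<le> of_int a' / 2 ^ e'"
       "(real_of_int a' + 1) / 2 ^ e' \<le> (of_int a + 1) * 2 ^ (e' - e) / 2 ^ e'"
    by (simp_all only: divide_right_mono zero_le_power zero_le_numeral)
  then have "real_of_int a / 2 ^ e \<le> of_int a' / 2 ^ e'"
       "(real_of_int a' + 1) / 2 ^ e' \<le> (of_int a + 1) / 2 ^ e"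
    by (simp_all add: split)
  then show ?thesis by auto
qed

lemma cell_subset:
  assumes "e \<le> e'" and "Q' \<in> subcells e e' Q"
  shows "cell e' Q' \<subseteq> cell e Q"
  using assms dyadic_subinterval[OF assms(1)]
  unfolding cell_def subcells_def by (intro Sigma_mono) (auto simp: mem_Times_iff)

lemma dyadic_blocks:
  fixes a :: int and m n :: nat
  shows "(b \<in> {a * 2 ^ (m + n) ..< (a + 1) * 2 ^ (m + n)}) \<longleftrightarrow>
     (b div 2 ^ n \<in> {a * 2 ^ m ..< (a + 1) * 2 ^ m})"
proof -
  have le: "k * 2 ^ n \<le> b \<longleftrightarrow> k \<le> b div 2 ^ n" for k
  proof
    assume "k * 2 ^ n \<le> b"
    then show "k \<le> b div 2 ^ n" using zdiv_mono1[of "k * 2 ^ n" b "2 ^ n"] by simp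
  next
    assume "k \<le> b div 2 ^ n"
    then have "k * 2 ^ n \<le> (b div 2 ^ n) * 2 ^ n" by (rule mult_right_mono) simp
    also have "\<dots> \<le> b" by (simp flip: minus_mod_eq_div_mult)
    finally show "k * 2 ^ n \<le> b" .
  qed
  show ?thesis
    using le[of "a * 2 ^ m"] le[of "(a + 1) * 2 ^ m"]
    by (simp add: power_add mult.assoc flip: not_le)
qed

text \<open>Integer division of both indices by \<open>2 ^ (e'' - e')\<close> gives the unique
  ancestor at level \<open>e'\<close>, so the sets of descendants are disjoint.\<close>

lemma sum_card_subcells:
  assumes "e \<le> e'" "e' \<le> e''"
  shows "(\<Sum>Q'\<in>subcells e e' Q. card (subcells e' e'' Q' \<inter> B)) = card (subcells e e'' Q \<inter> B)"
proof -
  define p where "p R = (fst R div 2 ^ (e'' - e'), snd R div 2 ^ (e'' - e'))" for R :: "int \<times> int"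
  have n: "e'' - e = (e' - e) + (e'' - e')" using assms by simp
  have mem: "R \<in> subcells e' e'' Q' \<longleftrightarrow> p R = Q'" for R Q'
    using dyadic_blocks[of "fst R" "fst Q'" 0 "e'' - e'"] dyadic_blocks[of "snd R" "snd Q'" 0 "e'' - e'"]
    by (auto simp: subcells_def p_def mem_Times_iff prod_eq_iff)
  have mem2: "R \<in> subcells e e'' Q \<longleftrightarrow> p R \<in> subcells e e' Q" for R
    unfolding subcells_def n mem_Times_iff dyadic_blocks by (simp add: p_def)
  have "subcells e e'' Q \<inter> B = (\<Union>Q'\<in>subcells e e' Q. subcells e' e'' Q' \<inter> B)"
    by (simp add: set_eq_iff mem mem2)
  also have "card \<dots> = (\<Sum>Q'\<in>subcells e e' Q. card (subcells e' e'' Q' \<inter> B))"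
    by (rule card_UN_disjoint) (use mem in \<open>auto simp: finite_subcells\<close>)
  finally show ?thesis ..
qed

lemma card_int_between:
  fixes u v :: real
  assumes "u \<le> v + 1"
  shows "finite {a::int. u \<le> a \<and> a \<le> v}" and "real (card {a::int. u \<le> a \<and> a \<le> v}) \<le> v - u + 1"
proof -
  have eq: "{a::int. u \<le> a \<and> a \<le> v} = {\<lceil>u\<rceil>..\<lfloor>v\<rfloor>}"
    by (auto simp: ceiling_le_iff le_floor_iff)
  show "finite {a::int. u \<le> a \<and> a \<le> v}" unfolding eq by simp
  show "real (card {a::int. u \<le> a \<and> a \<le> v}) \<le> v - u + 1"
    unfolding eq using assms by (cases "\<lceil>u\<rceil> \<le> \<lfloor>v\<rfloor> + 1") (simp_all, linarith+)
qed

text \<open>Around one of its points, \<open>U\<close> reaches at most \<open>d\<close> in each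
  coordinate. This leaves at most \<open>2 * (2 ^ e * d) + 2\<close> columns and as many
  rows.\<close>

lemma card_meeting_cells:
  fixes U :: "(real \<times> real) set"
  assumes "\<And>p q. p \<in> U \<Longrightarrow> q \<in> U \<Longrightarrow> dist p q \<le> d" and "0 < d"
  shows "real (card {Q \<in> F. U \<inter> cell e Q \<noteq> {}}) \<le> 16 * (max 1 (2 ^ e * d))\<^sup>2"
proof (cases "U = {}")
  case False
  then obtain \<alpha> \<beta> where ab: "(\<alpha>, \<beta>) \<in> U" by auto
  define I where "I t = {a::int. 2 ^ e * (t - d) - 1 \<le> a \<and> a \<le> 2 ^ e * (t + d)}" for t :: real
  have dp: "0 < 2 ^ e * d" using assms by simp
  have I: "finite (I t)" "card (I t) \<le> 2 * (2 ^ e * d) + 2" for t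
    unfolding I_def using card_int_between[of "2 ^ e * (t - d) - 1" "2 ^ e * (t + d)"] dp
    by (auto simp: algebra_simps)
  have I': "a \<in> I t" if "u \<in> {of_int a / 2 ^ e .. (of_int a + 1) / 2 ^ e}" "\<bar>t - u\<bar> \<le> d" for a t u
  proof -
    have "of_int a \<le> 2 ^ e * u" "2 ^ e * u \<le> of_int a + 1" using that(1) by (auto simp: field_simps)
    moreover have "2 ^ e * (t - d) \<le> 2 ^ e * u" "2 ^ e * u \<le> 2 ^ e * (t + d)"
      using that(2) by (auto intro!: mult_left_mono)
    ultimately show ?thesis unfolding I_def mem_Collect_eq by linarith
  qed
  have sub: "{Q \<in> F. U \<inter> cell e Q \<noteq> {}} \<subseteq> I \<alpha> \<times> I \<beta>"
  proof
    fix Q assume "Q \<in> {Q \<in> F. U \<inter> cell e Q \<noteq> {}}"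
    then obtain w where w: "w \<in> U" "w \<in> cell e Q" by auto
    have "\<bar>\<alpha> - fst w\<bar> \<le> d" "\<bar>\<beta> - snd w\<bar> \<le> d"
      using assms(1)[OF ab w(1)] dist_fst_le[of "(\<alpha>,\<beta>)" w] dist_snd_le[of "(\<alpha>,\<beta>)" w]
      by (simp_all add: dist_real_def)
    then have "fst Q \<in> I \<alpha>" "snd Q \<in> I \<beta>"
      using I' w(2) unfolding cell_def mem_Times_iff by blast+
    then show "Q \<in> I \<alpha> \<times> I \<beta>" by (simp add: mem_Times_iff)
  qed
  have "card {Q \<in> F. U \<inter> cell e Q \<noteq> {}} \<le> card (I \<alpha>) * card (I \<beta>)"
    using card_mono[OF _ sub] I(1) by (simp add: card_cartesian_product)
  then have "real (card {Q \<in> F. U \<inter> cell e Q \<noteq> {}}) \<le> real (card (I \<alpha>)) * real (card (I \<beta>))"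
    by (simp only: of_nat_le_iff flip: of_nat_mult)
  also have "\<dots> \<le> (4 * max 1 (2 ^ e * d)) * (4 * max 1 (2 ^ e * d))"
  proof -
    have "card (I t) \<le> 4 * max 1 (2 ^ e * d)" for t
      using I(2)[of t] by linarith
    then show ?thesis by (intro mult_mono) auto
  qed
  finally show ?thesis by (simp add: power2_eq_square)
qed simp

section \<open>Squares meeting strips around integer lines\<close>

text \<open>The progression \<open>a * h + \<theta>\<close> sweeps a length \<open>n * h\<close>.
  The first factor bounds the integers that come within reach, the second the terms close to any one
  of them.\<close>

lemma card_line_near_int:
  fixes h \<theta> \<epsilon> :: real and A :: int and n :: nat
  assumes "0 < h" "0 < \<epsilon>"
  shows "real (card {a\<in>{A..<A + int n}. \<exists>p::int. \<bar>a * h + \<theta> - p\<bar> \<le> \<epsilon>})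
      \<le> (n * h + 2 * \<epsilon> + 1) * (2 * \<epsilon> / h + 1)"
proof -
  define P where "P = {p::int. A * h + \<theta> - \<epsilon> \<le> p \<and> p \<le> (A + n) * h + \<theta> + \<epsilon>}"
  define S where "S p = {a::int. (p - \<theta> - \<epsilon>) / h \<le> a \<and> a \<le> (p - \<theta> + \<epsilon>) / h}" for p :: int
  have nh: "0 \<le> real n * h" using assms by simp
  have P: "finite P" "card P \<le> n * h + 2 * \<epsilon> + 1"
    unfolding P_def using card_int_between[of "A * h + \<theta> - \<epsilon>" "(A + n) * h + \<theta> + \<epsilon>"] assms nh
    by (auto simp: algebra_simps)
  have S: "finite (S p)" "card (S p) \<le> 2 * \<epsilon> / h + 1" for p
  proof -
    have "0 < 2 * \<epsilon> / h" using assms by simp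
    moreover have "(p - \<theta> + \<epsilon>) / h - (p - \<theta> - \<epsilon>) / h = 2 * \<epsilon> / h"
      by (simp add: diff_divide_distrib add_divide_distrib)
    ultimately show "finite (S p)" "card (S p) \<le> 2 * \<epsilon> / h + 1"
      unfolding S_def using card_int_between[of "(p - \<theta> - \<epsilon>) / h" "(p - \<theta> + \<epsilon>) / h"] by auto
  qed
  have "{a\<in>{A..<A + int n}. \<exists>p::int. \<bar>a * h + \<theta> - p\<bar> \<le> \<epsilon>} \<subseteq> (\<Union>p\<in>P. S p)"
  proof clarsimp
    fix a p :: int
    assume a: "A \<le> a" "a < A + int n" and p: "\<bar>a * h + \<theta> - p\<bar> \<le> \<epsilon>"
    have "real_of_int A \<le> a" "real_of_int a \<le> A + n" using a by linarith+
    then have "A * h \<le> a * h" "a * h \<le> (A + n) * h"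
      using assms by (intro mult_right_mono; simp)+
    then have "p \<in> P" unfolding P_def using p by auto
    moreover have "a \<in> S p" unfolding S_def using p assms(1) by (simp add: field_simps) linarith
    ultimately show "\<exists>p\<in>P. a \<in> S p" by blast
  qed
  then have "card {a\<in>{A..<A + int n}. \<exists>p::int. \<bar>a * h + \<theta> - p\<bar> \<le> \<epsilon>} \<le> card (\<Union>p\<in>P. S p)"
    by (intro card_mono) (use P S in auto)
  also have "\<dots> \<le> (\<Sum>p\<in>P. card (S p))" by (rule card_UN_le[OF P(1)])
  finally have "real (card {a\<in>{A..<A + int n}. \<exists>p::int. \<bar>a * h + \<theta> - p\<bar> \<le> \<epsilon>}) \<le> (\<Sum>p\<in>P. real (card (S p)))"
    by (simp only: of_nat_le_iff flip: of_nat_sum)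
  also have "\<dots> \<le> (\<Sum>p\<in>P. 2 * \<epsilon> / h + 1)" by (rule sum_mono) (rule S)
  also have "\<dots> = card P * (2 * \<epsilon> / h + 1)" by simp
  also have "\<dots> \<le> (n * h + 2 * \<epsilon> + 1) * (2 * \<epsilon> / h + 1)"
    by (rule mult_right_mono) (use P assms in auto)
  finally show ?thesis .
qed

lemma card_prod_rows_le:
  fixes K :: real
  assumes "finite J" "\<And>b. b \<in> J \<Longrightarrow> card {a\<in>I. P a b} \<le> K"
  shows "card {(a, b). a \<in> I \<and> b \<in> J \<and> P a b} \<le> card J * K"
proof -
  have "{(a, b). a \<in> I \<and> b \<in> J \<and> P a b} = (\<Union>b\<in>J. {a\<in>I. P a b} \<times> {b})" by auto
  also have "card \<dots> \<le> (\<Sum>b\<in>J. card ({a\<in>I. P a b} \<times> {b}))" by (rule card_UN_le[OF assms(1)])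
  finally have "real (card {(a, b). a \<in> I \<and> b \<in> J \<and> P a b}) \<le> (\<Sum>b\<in>J. real (card {a\<in>I. P a b}))"
    by (simp add: card_cartesian_product flip: of_nat_sum)
  also have "\<dots> \<le> card J * K" using sum_mono[OF assms(2), of J] by simp
  finally show ?thesis .
qed

lemma card_prod_columns_le:
  fixes K :: real
  assumes "finite I" "\<And>a. a \<in> I \<Longrightarrow> card {b\<in>J. P a b} \<le> K"
  shows "card {(a, b). a \<in> I \<and> b \<in> J \<and> P a b} \<le> card I * K"
proof -
  have "{(a, b). a \<in> I \<and> b \<in> J \<and> P a b} = prod.swap ` {(b, a). b \<in> J \<and> a \<in> I \<and> P a b}"
    by (auto simp: image_iff)
  then have "card {(a, b). a \<in> I \<and> b \<in> J \<and> P a b} = card {(b, a). b \<in> J \<and> a \<in> I \<and> P a b}"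
    by (simp add: card_image)
  then show ?thesis using card_prod_rows_le[of I J "\<lambda>b a. P a b" K] assms by simp
qed

text \<open>Since \<open>n * h\<close> is at least one full period and the step \<open>h\<close> is
  finer than \<open>\<epsilon>\<close>, the proportion of terms near an integer is of the expected
  order \<open>\<epsilon>\<close>.\<close>

lemma card_fine_line_near_int:
  fixes h \<theta> \<epsilon> :: real and A :: int and n :: nat
  assumes "0 < h" "1 \<le> n * h" "2 * h \<le> \<epsilon>" "\<epsilon> \<le> 1 / 4"
  shows "card {a\<in>{A..<A + int n}. \<exists>p::int. \<bar>a * h + \<theta> - p\<bar> \<le> 2 * \<epsilon>} \<le> 15 * \<epsilon> * n"
proof -
  have "real (card {a\<in>{A..<A + int n}. \<exists>p::int. \<bar>a * h + \<theta> - p\<bar> \<le> 2 * \<epsilon>})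
      \<le> (n * h + 2 * (2 * \<epsilon>) + 1) * (2 * (2 * \<epsilon>) / h + 1)"
    by (rule card_line_near_int) (use assms in auto)
  also have "\<dots> \<le> (3 * (n * h)) * (5 * \<epsilon> / h)"
    by (rule mult_mono) (use assms in \<open>auto simp: field_simps\<close>)
  also have "\<dots> = 15 * \<epsilon> * n" using assms by simp
  finally show ?thesis .
qed

text \<open>Fix the index that belongs to the smaller coefficient and let the other one run. It
  gives a progression of step \<open>max x y / 2 ^ e'\<close> and total length
  \<open>max x y / 2 ^ e\<close>, which is at least 1.\<close>

lemma card_cells_meeting_strips:
  fixes x y :: nat and \<epsilon> :: real
  assumes xy: "0 < x" "0 < y" and e: "e \<le> e'" and large: "2 ^ e \<le> real (max x y)"
    and small: "2 * real (max x y) / 2 ^ e' \<le> \<epsilon>" "\<epsilon> \<le> 1 / 4"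
  shows "card {R \<in> subcells e e' Q. \<exists>w\<in>cell e' R. \<exists>p::int. \<bar>x * fst w + y * snd w - p\<bar> < \<epsilon>}
       \<le> 15 * \<epsilon> * 4 ^ (e' - e)"
proof -
  define n :: nat where "n = 2 ^ (e' - e)"
  define I where "I k = {k * int n ..< k * int n + int n}" for k
  define h where "h z = real z / 2 ^ e'" for z :: nat
  define P where "P a b \<longleftrightarrow> (\<exists>p::int. \<bar>a * h x + b * h y - p\<bar> \<le> 2 * \<epsilon>)" for a b :: int
  have sc: "subcells e e' Q = I (fst Q) \<times> I (snd Q)"
    unfolding subcells_def I_def n_def by (simp add: algebra_simps)
  have fin: "finite (I k)" and card: "card (I k) = n" for k unfolding I_def by auto
  have n2: "real n * n = 4 ^ (e' - e)" unfolding n_def by (simp flip: power_mult_distrib)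
  have n_split: "2 ^ e' = real n * 2 ^ e" unfolding n_def using e by (simp flip: power_add)
  have h_pos: "0 < h x" "0 < h y" using xy by (auto simp: h_def)
  have sum_h: "h x + h y \<le> \<epsilon>"
  proof -
    have "h x + h y = (real x + real y) / 2 ^ e'" by (simp add: h_def add_divide_distrib)
    also have "\<dots> \<le> 2 * real (max x y) / 2 ^ e'" by (rule divide_right_mono) auto
    finally show ?thesis using small by linarith
  qed
  have sub: "{R \<in> subcells e e' Q. \<exists>w\<in>cell e' R. \<exists>p::int. \<bar>x * fst w + y * snd w - p\<bar> < \<epsilon>}
      \<subseteq> {(a, b). a \<in> I (fst Q) \<and> b \<in> I (snd Q) \<and> P a b}"
  proof
    fix R assume "R \<in> {R \<in> subcells e e' Q. \<exists>w\<in>cell e' R. \<exists>p::int. \<bar>x * fst w + y * snd w - p\<bar> < \<epsilon>}"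
    then obtain w :: "real \<times> real" and p :: int where R: "R \<in> subcells e e' Q" and w: "w \<in> cell e' R"
      and p: "\<bar>x * fst w + y * snd w - of_int p\<bar> < \<epsilon>" by auto
    have lin: "of_int a * h z \<le> z * u \<and> z * u \<le> of_int a * h z + h z"
      if "u \<in> {of_int a / 2 ^ e' .. (of_int a + 1) / 2 ^ e'}" for z u and a :: int
    proof -
      have "z * (of_int a / 2 ^ e') \<le> z * u" "z * u \<le> z * ((of_int a + 1) / 2 ^ e')"
        using that by (intro mult_left_mono; simp)+
      then show ?thesis by (simp add: h_def field_simps)
    qed
    \<comment> \<open>Moving from \<open>w\<close> to the lower left corner of its square changes
      the linear form by at most \<open>h x + h y \<le> \<epsilon>\<close>, hence the doubled
      width.\<close>
    have "\<bar>of_int (fst R) * h x + of_int (snd R) * h y - of_int p\<bar> \<le> 2 * \<epsilon>"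
      using lin[of "fst w" "fst R" x] lin[of "snd w" "snd R" y] w p sum_h
      unfolding cell_def mem_Times_iff by linarith
    then have "P (fst R) (snd R)" unfolding P_def by blast
    then show "R \<in> {(a, b). a \<in> I (fst Q) \<and> b \<in> I (snd Q) \<and> P a b}"
      using R by (auto simp: sc)
  qed
  have count: "card {a \<in> I k. \<exists>p::int. \<bar>a * h z + \<theta> - p\<bar> \<le> 2 * \<epsilon>} \<le> 15 * \<epsilon> * n"
    if "z = max x y" for z k \<theta>
    unfolding I_def
  proof (rule card_fine_line_near_int)
    have "0 < z" using that xy by simp
    then show "0 < h z" by (simp add: h_def)
    show "1 \<le> real n * h z"
      using large that unfolding h_def n_split by (simp add: n_def)
    show "2 * h z \<le> \<epsilon>" using small that by (simp add: h_def)
  qed (use small in auto)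
  have "card {(a, b). a \<in> I (fst Q) \<and> b \<in> I (snd Q) \<and> P a b} \<le> n * (15 * \<epsilon> * n)"
  proof (cases "y \<le> x")
    case True
    have "card {a \<in> I (fst Q). P a b} \<le> 15 * \<epsilon> * n" for b
      unfolding P_def using count[of x "fst Q" "b * h y"] True by (simp add: algebra_simps)
    from card_prod_rows_le[where P=P, OF fin this, of "snd Q"] show ?thesis by (simp only: card)
  next
    case False
    have "card {b \<in> I (snd Q). P a b} \<le> 15 * \<epsilon> * n" for a
      unfolding P_def using count[of y "snd Q" "a * h x"] False by (simp add: algebra_simps)
    from card_prod_columns_le[where P=P, OF fin this, of "fst Q"] show ?thesis by (simp only: card)
  qed
  also have "n * (15 * \<epsilon> * n) = 15 * \<epsilon> * 4 ^ (e' - e)" by (simp flip: n2)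
  finally have "card {(a, b). a \<in> I (fst Q) \<and> b \<in> I (snd Q) \<and> P a b} \<le> 15 * \<epsilon> * 4 ^ (e' - e)" .
  moreover have "finite {(a, b). a \<in> I (fst Q) \<and> b \<in> I (snd Q) \<and> P a b}"
    by (rule finite_subset[of _ "I (fst Q) \<times> I (snd Q)"]) (auto simp: fin)
  ultimately show ?thesis using card_mono[OF _ sub] by (meson of_nat_le_iff order_trans)
qed

section \<open>Total proportion of squares met by a block of strips\<close>

lemma sum_inverse_below_power2: "(\<Sum>x\<in>{1..<2 ^ m}. 1 / real x) \<le> m"
proof (induction m)
  case (Suc m)
  have "{1..<2 ^ Suc m} = {1..<2 ^ m} \<union> {2 ^ m..<2 ^ Suc m :: nat}"
    by (rule ivl_disj_un(17)[symmetric]) auto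
  then have "(\<Sum>x\<in>{1..<2 ^ Suc m}. 1 / real x)
      = (\<Sum>x\<in>{1..<2 ^ m}. 1 / real x) + (\<Sum>x\<in>{2 ^ m..<2 ^ Suc m}. 1 / real x)"
    by (simp add: sum.union_disjoint)
  also have "(\<Sum>x\<in>{2 ^ m..<2 ^ Suc m}. 1 / real x) \<le> (\<Sum>x\<in>{2 ^ m..<2 ^ Suc m :: nat}. 1 / 2 ^ m)"
    by (rule sum_mono) (simp add: frac_le)
  also have "\<dots> = 1" by simp
  finally show ?case using Suc by simp
qed simp

text \<open>The constant \<open>c\<close> is \<open>1 / 2 ^ 17\<close>. With \<open>e\<close>
  running through \<open>E * 8 ^ k\<close>, the ranges from \<open>4 ^ e\<close> to
  \<open>4 ^ (8 * e)\<close> follow each other without gaps and cover all products from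
  \<open>4 ^ E\<close> on.\<close>

definition bad_cells :: "nat \<Rightarrow> (int \<times> int) set" where
  "bad_cells e = {R. \<exists>x y :: nat. 0 < x \<and> 0 < y \<and> 4 ^ e \<le> x * y \<and> x * y < 4 ^ (8 * e) \<and>
     (\<exists>w\<in>cell (64 * e) R. \<exists>p::int. \<bar>x * fst w + y * snd w - p\<bar> < 1 / (2 ^ 17 * real (x * y) * (real e)\<^sup>2))}"

text \<open>Summing the strip counts over all pairs gives a product of two harmonic sums, each at
  most \<open>16 * e\<close>. The factor \<open>(real e)\<^sup>2\<close> in the width cancels this
  growth and leaves a proportion independent of \<open>e\<close>.\<close>

lemma card_bad_cells:
  assumes "1 \<le> e"
  shows "card (subcells e (64 * e) Q \<inter> bad_cells e) \<le> 4 ^ (63 * e) / (32 :: real)"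
proof -
  define \<epsilon> where "\<epsilon> z = 1 / (2 ^ 17 * real (fst z * snd z) * (real e)\<^sup>2)" for z :: "nat \<times> nat"
  define T where "T z = {R \<in> subcells e (64 * e) Q. \<exists>w\<in>cell (64 * e) R. \<exists>p::int.
     \<bar>fst z * fst w + snd z * snd w - p\<bar> < \<epsilon> z}" for z :: "nat \<times> nat"
  define X :: "nat set" where "X = {1..<2 ^ (16 * e)}"
  define Z where "Z = {z \<in> X \<times> X. 4 ^ e \<le> fst z * snd z \<and> fst z * snd z < 4 ^ (8 * e)}"
  have finZ: "finite Z" unfolding Z_def X_def by simp
  have four: "4 ^ k = (2 ^ (2 * k) :: nat)" "4 ^ k = (2 ^ (2 * k) :: real)" for k by (simp_all add: power_mult)
  have sub: "subcells e (64 * e) Q \<inter> bad_cells e \<subseteq> (\<Union>z\<in>Z. T z)"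
  proof
    fix R assume "R \<in> subcells e (64 * e) Q \<inter> bad_cells e"
    then obtain x y :: nat where R: "R \<in> subcells e (64 * e) Q" and xy: "0 < x" "0 < y" "4 ^ e \<le> x * y" "x * y < 4 ^ (8 * e)"
      and ex: "\<exists>w\<in>cell (64 * e) R. \<exists>p::int. \<bar>x * fst w + y * snd w - p\<bar> < 1 / (2 ^ 17 * real (x * y) * (real e)\<^sup>2)"
      unfolding bad_cells_def by blast
    have "x \<le> x * y" "y \<le> x * y" using xy by auto
    moreover have "x * y < 2 ^ (16 * e)" using xy(4) four(1)[of "8 * e"] by simp
    ultimately have "x < 2 ^ (16 * e)" "y < 2 ^ (16 * e)" by linarith+
    then have "(x, y) \<in> Z" unfolding Z_def X_def using xy by auto
    moreover have "R \<in> T (x, y)" unfolding T_def \<epsilon>_def using R ex by simp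
    ultimately show "R \<in> (\<Union>z\<in>Z. T z)" by blast
  qed
  have T: "card (T z) \<le> 15 * \<epsilon> z * 4 ^ (63 * e)" if "z \<in> Z" for z
  proof -
    obtain x y where z: "z = (x, y)" by force
    have xy: "0 < x" "0 < y" "4 ^ e \<le> x * y" "x * y < 4 ^ (8 * e)"
      using that unfolding Z_def X_def z by auto
    define M where "M = max x y"
    \<comment> \<open>The lower bound on the product forces the larger factor to be at least
      \<open>2 ^ e\<close>, as equidistribution in a square of level \<open>e\<close>
      requires.\<close>
    have MM: "x * y \<le> M * M" unfolding M_def by (intro mult_mono) auto
    have M_le: "M \<le> x * y" unfolding M_def using xy by auto
    have "(2 ^ e)\<^sup>2 = (4 ^ e :: nat)" unfolding four(1) power_mult[symmetric] by (simp add: mult.commute)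
    then have "(2 ^ e)\<^sup>2 \<le> M\<^sup>2" using MM xy(3) unfolding power2_eq_square[of M] by linarith
    then have "2 ^ e \<le> M" by (rule power2_le_imp_le) simp
    then have large: "2 ^ e \<le> real M" by (metis of_nat_le_iff of_nat_numeral of_nat_power)
    define m where "m = real (x * y)"
    have m: "1 \<le> m" "m < 2 ^ (16 * e)"
    proof -
      have "1 \<le> x * y" using xy(1,2) by (simp add: Suc_le_eq)
      then have "real 1 \<le> real (x * y)" by (simp only: of_nat_le_iff)
      then show "1 \<le> m" unfolding m_def by simp
      have "x * y < 2 ^ (16 * e)" using xy(4) four(1)[of "8 * e"] by simp
      then have "real (x * y) < real (2 ^ (16 * e))" by (simp only: of_nat_less_iff)
      then show "m < 2 ^ (16 * e)" unfolding m_def by simp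
    qed
    have Mm: "real M \<le> m" unfolding m_def using M_le by (simp only: of_nat_le_iff)
    have e1: "1 \<le> (real e)\<^sup>2" using assms by simp
    have e2: "real e \<le> 2 ^ e" by (metis less_exp less_imp_le of_nat_le_iff of_nat_numeral of_nat_power)
    have eps: "\<epsilon> z = 1 / (2 ^ 17 * m * (real e)\<^sup>2)" by (simp add: \<epsilon>_def z m_def)
    \<comment> \<open>Here level \<open>64 * e\<close> proves fine enough: twice the side times
      \<open>M\<close> stays below the strip width because
      \<open>18 + 34 * e \<le> 64 * e\<close>.\<close>
    have "2 * real M * (2 ^ 17 * m * (real e)\<^sup>2) \<le> 2 * m * (2 ^ 17 * m * (2 ^ e)\<^sup>2)"
      using Mm e2 m by (intro mult_mono power_mono) simp_all
    also have "\<dots> = 2 ^ 18 * (m * m) * (2 ^ e)\<^sup>2" by simp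
    also have "\<dots> \<le> 2 ^ 18 * (2 ^ (16 * e) * 2 ^ (16 * e)) * (2 ^ e)\<^sup>2"
      using m by (intro mult_mono) simp_all
    also have "\<dots> = 2 ^ (18 + 34 * e)" unfolding power_mult[symmetric] power_add[symmetric]
      by (rule arg_cong[of _ _ "power 2"]) simp
    also have "\<dots> \<le> 2 ^ (64 * e)" using assms by (intro power_increasing) auto
    finally have small: "2 * real M / 2 ^ (64 * e) \<le> \<epsilon> z"
      unfolding eps using m e1 assms by (simp add: divide_simps)
    have "1 * 1 * 4 \<le> m * (real e)\<^sup>2 * (2 ^ 17 :: real)" using m e1 by (intro mult_mono) auto
    then have "\<epsilon> z \<le> 1 / 4" unfolding eps by (intro divide_left_mono) auto
    then have "card (T (x, y)) \<le> 15 * \<epsilon> z * 4 ^ (64 * e - e)"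
      using card_cells_meeting_strips[of x y e "64 * e" "\<epsilon> z" Q] xy large small
      unfolding T_def z M_def by simp
    moreover have "64 * e - e = 63 * e" by simp
    ultimately show ?thesis by (simp add: z)
  qed
  have "card (subcells e (64 * e) Q \<inter> bad_cells e) \<le> card (\<Union>z\<in>Z. T z)"
    by (rule card_mono[OF _ sub]) (use finZ in \<open>auto simp: T_def finite_subcells\<close>)
  also have "\<dots> \<le> (\<Sum>z\<in>Z. card (T z))" by (rule card_UN_le[OF finZ])
  finally have "real (card (subcells e (64 * e) Q \<inter> bad_cells e)) \<le> (\<Sum>z\<in>Z. real (card (T z)))"
    by (simp only: of_nat_le_iff flip: of_nat_sum)
  also have "\<dots> \<le> (\<Sum>z\<in>Z. 15 * \<epsilon> z * 4 ^ (63 * e))" by (rule sum_mono) (rule T)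
  \<comment> \<open>Dropping the restriction on the product makes the double sum factor.\<close>
  also have "\<dots> \<le> (\<Sum>z\<in>X \<times> X. 15 * \<epsilon> z * 4 ^ (63 * e))"
    by (rule sum_mono2) (auto simp: X_def Z_def \<epsilon>_def)
  also have "\<dots> = 15 * 4 ^ (63 * e) / (2 ^ 17 * (real e)\<^sup>2) * (\<Sum>z\<in>X \<times> X. (1 / real (fst z)) * (1 / real (snd z)))"
    unfolding sum_distrib_left by (rule sum.cong) (auto simp: \<epsilon>_def)
  also have "(\<Sum>z\<in>X \<times> X. (1 / real (fst z)) * (1 / real (snd z))) = (\<Sum>x\<in>X. 1 / real x) * (\<Sum>y\<in>X. 1 / real y)"
    unfolding sum_product by (simp add: sum.cartesian_product case_prod_beta)
  also have "15 * 4 ^ (63 * e) / (2 ^ 17 * (real e)\<^sup>2) * \<dots>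
      \<le> 15 * 4 ^ (63 * e) / (2 ^ 17 * (real e)\<^sup>2) * (real (16 * e) * real (16 * e))"
    using sum_inverse_below_power2[of "16 * e"]
    by (intro mult_left_mono mult_mono) (auto simp: X_def intro!: sum_nonneg)
  also have "\<dots> = (15 * 256 / 2 ^ 17) * 4 ^ (63 * e)"
    using assms by (simp add: power2_eq_square)
  also have "\<dots> \<le> (1 / 32) * 4 ^ (63 * e)" by (rule mult_right_mono) auto
  finally show ?thesis by simp
qed

section \<open>Choosing a subsquare that avoids strips and covering sets\<close>

lemma markov_card:
  fixes f :: "'a \<Rightarrow> real"
  assumes "finite C" "\<And>x. x \<in> C \<Longrightarrow> 0 \<le> f x"
  shows "t * card {x\<in>C. t \<le> f x} \<le> sum f C"
proof -
  have "t * card {x\<in>C. t \<le> f x} = (\<Sum>x\<in>{x\<in>C. t \<le> f x}. t)" by simp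
  also have "\<dots> \<le> (\<Sum>x\<in>{x\<in>C. t \<le> f x}. f x)" by (rule sum_mono) auto
  also have "\<dots> \<le> sum f C" by (rule sum_mono2) (use assms in auto)
  finally show ?thesis .
qed

text \<open>The numbers \<open>d i\<close> only bound the diameters from above. Their positivity
  ensures that each covering set, even a single point, is dealt with at some finite level.\<close>

locale thin_cover =
  fixes U :: "nat \<Rightarrow> (real \<times> real) set" and d :: "nat \<Rightarrow> real" and s :: real
  assumes diam: "p \<in> U i \<Longrightarrow> q \<in> U i \<Longrightarrow> dist p q \<le> d i"
    and d_pos: "0 < d i" and s_pos: "0 < s" and s_less: "s < 2"
    and summable_d: "summable (\<lambda>i. d i powr s)"
begin

text \<open>The cost of a covering set is measured relative to the side of the square, which makes
  one threshold serve all levels. Larger sets are left out because earlier levels have already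
  avoided them.\<close>

definition weight_term :: "nat \<Rightarrow> int \<times> int \<Rightarrow> nat \<Rightarrow> real" where
  "weight_term e Q i = (if d i < 1 / 2 ^ e \<and> U i \<inter> cell e Q \<noteq> {} then (2 ^ e * d i) powr s else 0)"

definition weight :: "nat \<Rightarrow> int \<times> int \<Rightarrow> real" where
  "weight e Q = (\<Sum>i. weight_term e Q i)"

lemma summable_scaled: "summable (\<lambda>i. (2 ^ e * d i) powr s)"
  using summable_mult[OF summable_d, of "(2 ^ e) powr s"] d_pos
  by (simp add: powr_mult less_imp_le)

lemma summable_weight_term: "summable (weight_term e Q)"
  by (rule summable_comparison_test'[OF summable_scaled[of e], of 0]) (auto simp: weight_term_def)

text \<open>
  Covering sets of diameter between \<open>2\<^sup>-\<^sup>8\<^sup>e\<close> and \<open>2\<^sup>-\<^sup>e\<close> get the weight \<open>1/128\<close> of the threshold, so that a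
  total below \<open>1/128\<close> means at once that none of them meets the subsquare and that the smaller ones
  have total weight below the threshold at the next level.
\<close>

definition child_term :: "nat \<Rightarrow> int \<times> int \<Rightarrow> nat \<Rightarrow> real" where
  "child_term e R i = (if d i < 1 / 2 ^ e \<and> U i \<inter> cell (8 * e) R \<noteq> {}
     then (if d i < 1 / 2 ^ (8 * e) then (2 ^ (8 * e) * d i) powr s else 1 / 128) else 0)"

lemma child_term_nonneg: "0 \<le> child_term e R i"
  by (simp add: child_term_def)

lemma summable_child_term: "summable (child_term e R)"
proof (rule summable_comparison_test'[OF summable_scaled[of "8 * e"], of 0])
  fix i
  have "1 / 128 \<le> (2 ^ (8 * e) * d i) powr s" if "\<not> d i < 1 / 2 ^ (8 * e)"
  proof -
    have "1 \<le> 2 ^ (8 * e) * d i" using that by (simp add: field_simps)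
    then have "1 \<le> (2 ^ (8 * e) * d i) powr s" using s_pos by (simp add: ge_one_powr_ge_zero)
    then show ?thesis by simp
  qed
  then show "norm (child_term e R i) \<le> (2 ^ (8 * e) * d i) powr s"
    by (auto simp: child_term_def)
qed

text \<open>A set smaller than the subsquares meets at most 16 of them, and the rescaling factor
  \<open>2 ^ (7 * e)\<close> to the power \<open>s\<close> is beaten by \<open>4 ^ (7 * e)\<close>
  since \<open>1 \<le> e * (2 - s)\<close>. A larger one meets at most
  \<open>16 * 4 ^ (7 * e) * u\<^sup>2\<close> of them, each charged \<open>1 / 128\<close>, and
  \<open>u\<^sup>2 \<le> u powr s\<close>.\<close>

lemma sum_child_term:
  assumes e: "1 \<le> e" "1 \<le> e * (2 - s)"
  shows "(\<Sum>R\<in>subcells e (8 * e) Q. child_term e R i) \<le> 4 ^ (7 * e) / 8 * weight_term e Q i"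
proof (cases "d i < 1 / 2 ^ e \<and> U i \<inter> cell e Q \<noteq> {}")
  case False
  then have "child_term e R i = 0" if "R \<in> subcells e (8 * e) Q" for R
    using cell_subset[OF _ that] by (auto simp: child_term_def)
  then show ?thesis by (simp add: weight_term_def False)
next
  case True
  define C where "C = {R \<in> subcells e (8 * e) Q. U i \<inter> cell (8 * e) R \<noteq> {}}"
  define u where "u = 2 ^ e * d i"
  define w where "w = (if d i < 1 / 2 ^ (8 * e) then (2 ^ (8 * e) * d i) powr s else 1 / 128)"
  have u: "0 < u" "u \<le> 1" using True d_pos by (auto simp: u_def field_simps)
  have big: "2 ^ (8 * e) * d i = 2 ^ (7 * e) * u"
    unfolding u_def by (simp flip: power_add mult.assoc)
  have wt: "weight_term e Q i = u powr s" using True by (simp add: weight_term_def u_def)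
  have "(\<Sum>R\<in>subcells e (8 * e) Q. child_term e R i) = (\<Sum>R\<in>subcells e (8 * e) Q. if U i \<inter> cell (8 * e) R \<noteq> {} then w else 0)"
    by (rule sum.cong) (use True in \<open>auto simp: child_term_def w_def\<close>)
  also have "\<dots> = card C * w"
    unfolding C_def by (subst sum.inter_filter[symmetric]) (auto simp: finite_subcells)
  also have "\<dots> \<le> 16 * (max 1 (2 ^ (8 * e) * d i))\<^sup>2 * w"
    unfolding C_def by (intro mult_right_mono card_meeting_cells diam d_pos) (auto simp: w_def)
  also have "\<dots> \<le> 4 ^ (7 * e) / 8 * u powr s"
  proof (cases "d i < 1 / 2 ^ (8 * e)")
    case True
    then have "max 1 (2 ^ (8 * e) * d i) = 1" by (simp add: field_simps)
    moreover have "w = (2 ^ (7 * e)) powr s * u powr s"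
      using True u unfolding w_def big by (simp add: powr_mult)
    moreover have "16 * (2 ^ (7 * e)) powr s \<le> 4 ^ (7 * e) / (8::real)"
    proof -
      have "(128::real) * (2 ^ (7 * e)) powr s = 2 powr 7 * 2 powr (7 * e * s)"
        by (simp add: powr_powr flip: powr_realpow)
      also have "\<dots> = 2 powr (7 + 7 * e * s)" by (simp add: powr_add)
      also have "\<dots> \<le> 2 powr (14 * e)" using e by (simp add: algebra_simps)
      also have "\<dots> = 2 ^ (14 * e)" by (simp flip: powr_realpow)
      also have "\<dots> = (4::real) ^ (7 * e)" by (simp add: power_mult)
      finally show ?thesis by simp
    qed
    ultimately show ?thesis by (simp add: mult_right_mono flip: mult.assoc)
  next
    case False
    then have "max 1 (2 ^ (8 * e) * d i) = 2 ^ (7 * e) * u" unfolding big[symmetric] by (simp add: field_simps)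
    then have "16 * (max 1 (2 ^ (8 * e) * d i))\<^sup>2 * w = (2 ^ (7 * e))\<^sup>2 / 8 * u\<^sup>2"
      using False by (simp add: w_def power_mult_distrib)
    also have "(2 ^ (7 * e))\<^sup>2 = (4::real) ^ (7 * e)"
      by (simp add: power2_eq_square flip: power_mult_distrib)
    also have "u\<^sup>2 = u powr 2" using u by simp
    also have "4 ^ (7 * e) / 8 * u powr 2 \<le> 4 ^ (7 * e) / 8 * u powr s"
      using u s_less by (intro mult_left_mono powr_mono') auto
    finally show ?thesis .
  qed
  finally show ?thesis unfolding wt .
qed

lemma sum_suminf_child_term:
  assumes "1 \<le> e" "1 \<le> e * (2 - s)"
  shows "(\<Sum>R\<in>subcells e (8 * e) Q. suminf (child_term e R)) \<le> 4 ^ (7 * e) / 8 * weight e Q"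
proof -
  have "(\<Sum>R\<in>subcells e (8 * e) Q. suminf (child_term e R)) = (\<Sum>i. \<Sum>R\<in>subcells e (8 * e) Q. child_term e R i)"
    by (rule suminf_sum[symmetric]) (rule summable_child_term)
  also have "\<dots> \<le> (\<Sum>i. 4 ^ (7 * e) / 8 * weight_term e Q i)"
    by (intro suminf_le sum_child_term assms summable_sum summable_child_term summable_mult summable_weight_term)
  also have "\<dots> = 4 ^ (7 * e) / 8 * weight e Q"
    unfolding weight_def by (rule suminf_mult[OF summable_weight_term])
  finally show ?thesis .
qed

lemma light_child:
  assumes "suminf (child_term e R) < 1 / 128"
  shows "weight (8 * e) R \<le> 1 / 128"
    and "\<lbrakk>1 / 2 ^ (8 * e) \<le> d i; d i < 1 / 2 ^ e\<rbrakk> \<Longrightarrow> U i \<inter> cell (8 * e) R = {}"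
proof -
  have "1 / 2 ^ (8 * e) \<le> (1 / 2 ^ e :: real)" by (intro divide_left_mono power_increasing) auto
  then have "weight_term (8 * e) R i \<le> child_term e R i" for i
    by (auto simp: weight_term_def child_term_def)
  then have "weight (8 * e) R \<le> suminf (child_term e R)"
    unfolding weight_def by (intro suminf_le summable_child_term summable_weight_term)
  then show "weight (8 * e) R \<le> 1 / 128" using assms by linarith
  assume i: "1 / 2 ^ (8 * e) \<le> d i" "d i < 1 / 2 ^ e"
  have "sum (child_term e R) {i} \<le> suminf (child_term e R)"
    by (rule sum_le_suminf[OF summable_child_term]) (auto simp: child_term_nonneg)
  then have "child_term e R i < 1 / 128" using assms by simp
  then show "U i \<inter> cell (8 * e) R = {}"
    using i by (auto simp: child_term_def split: if_splits)
qed

text \<open>At most a quarter of the subsquares lie in \<open>B\<close>. By Markov's inequality at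
  most one eighth contain too many bad squares, and at most one eighth carry too much of the cover.
  Half of the subsquares survive.\<close>

lemma good_child:
  assumes e: "1 \<le> e" "1 \<le> e * (2 - s)"
    and B: "card (subcells e (8 * e) Q \<inter> B) \<le> 4 ^ (7 * e) / (4::real)"
    and Q: "weight e Q \<le> 1 / 128"
  shows "\<exists>R\<in>subcells e (8 * e) Q. R \<notin> B
    \<and> card (subcells (8 * e) (64 * e) R \<inter> bad_cells e) \<le> 4 ^ (56 * e) / (4::real)
    \<and> suminf (child_term e R) < 1 / 128"
proof (rule ccontr)
  assume neg: "\<not> ?thesis"
  define C where "C = subcells e (8 * e) Q"
  define f where "f R = real (card (subcells (8 * e) (64 * e) R \<inter> bad_cells e))" for R
  define K :: real where "K = 4 ^ (7 * e)"
  define K' :: real where "K' = 4 ^ (56 * e)"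
  have K: "0 < K" "0 < K'" by (auto simp: K_def K'_def)
  have fin: "finite C" unfolding C_def by (rule finite_subcells)
  define X where "X = {R\<in>C. K' / 4 \<le> f R}"
  define Y where "Y = {R\<in>C. 1 / 128 \<le> suminf (child_term e R)}"
  have cardC: "card C = K" unfolding C_def K_def card_subcells by simp
  have "sum f C = real (\<Sum>R\<in>C. card (subcells (8 * e) (64 * e) R \<inter> bad_cells e))"
    by (simp add: f_def)
  also have "\<dots> = card (subcells e (64 * e) Q \<inter> bad_cells e)"
    unfolding C_def by (subst sum_card_subcells) auto
  also have "\<dots> \<le> 4 ^ (63 * e) / 32" by (rule card_bad_cells) (rule e)
  also have "(4::real) ^ (63 * e) = K * K'" by (simp add: K_def K'_def flip: power_add)
  finally have "K' / 4 * card X \<le> K' / 4 * (K / 8)"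
    using markov_card[OF fin, of f "K' / 4"] unfolding X_def by (simp add: f_def mult.commute)
  then have X: "card X \<le> K / 8" using K by (simp only: mult_le_cancel_left_pos)
  have "1 / 128 * card Y \<le> (\<Sum>R\<in>C. suminf (child_term e R))"
    unfolding Y_def by (rule markov_card[OF fin]) (intro suminf_nonneg summable_child_term child_term_nonneg)
  also have "\<dots> \<le> K / 8 * weight e Q" unfolding C_def K_def by (rule sum_suminf_child_term[OF e])
  also have "\<dots> \<le> K / 8 * (1 / 128)" using Q K by (intro mult_left_mono) auto
  finally have Y: "card Y \<le> K / 8" by simp
  have "C \<subseteq> (C \<inter> B) \<union> X \<union> Y"
  proof
    fix R assume "R \<in> C"
    then show "R \<in> (C \<inter> B) \<union> X \<union> Y"
      using neg unfolding X_def Y_def f_def K'_def C_def by (force simp: not_le not_less)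
  qed
  then have "card C \<le> card ((C \<inter> B) \<union> X \<union> Y)"
    by (rule card_mono[rotated]) (auto simp: fin X_def Y_def)
  also have "\<dots> \<le> card (C \<inter> B) + card X + card Y"
    using card_Un_le[of "(C \<inter> B) \<union> X" Y] card_Un_le[of "C \<inter> B" X] by linarith
  finally have "K \<le> card (C \<inter> B) + card X + card Y" using cardC by linarith
  moreover have "card (C \<inter> B) \<le> K / 4" unfolding C_def K_def by (rule B)
  ultimately show False using X Y K by linarith
qed

end

section \<open>Constructing a point of the set outside the cover\<close>

lemma last_true:
  fixes P :: "nat \<Rightarrow> bool"
  assumes "P 0" "\<not> P n"
  shows "\<exists>k. P k \<and> \<not> P (Suc k)"
  using assms by (induction n) auto

definition littlewood_log_set :: "(real \<times> real) set" where
  "littlewood_log_set = {(\<alpha>::real, \<beta>::real). \<exists>c>0. \<exists>N::int. \<forall>x y :: nat. 0 < x \<longrightarrow> 0 < y \<longrightarrow> N \<le> int (x * y) \<longrightarrow>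
        max 2 (real (x * y)) * nint_dist (real x * \<alpha> + real y * \<beta>) * (ln (max 2 (real (x * y))))\<^sup>2 \<ge> c}"

text \<open>Every product from \<open>4 ^ E\<close> on belongs to one of the blocks. Avoiding its
  strips bounds the distance below in terms of \<open>e\<close>, and \<open>e\<close> is at most the
  logarithm of the product.\<close>

lemma littlewood_log_setI:
  assumes E: "1 \<le> E"
    and avoid: "\<And>k. \<exists>R. w \<in> cell (64 * (E * 8 ^ k)) R \<and> R \<notin> bad_cells (E * 8 ^ k)"
  shows "w \<in> littlewood_log_set"
proof -
  have "1 / 2 ^ 17 \<le> max 2 (real (x * y)) * nint_dist (real x * fst w + real y * snd w) * (ln (max 2 (real (x * y))))\<^sup>2"
    if xy: "0 < x" "0 < y" "4 ^ E \<le> int (x * y)" for x y :: nat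
  proof -
    have start: "4 ^ (E * 8 ^ 0) \<le> x * y"
      using xy(3) by (metis mult.right_neutral of_nat_le_iff of_nat_numeral of_nat_power power_0)
    \<comment> \<open>The index \<open>x * y\<close> is a crude but sufficient point at which the
      blocks have passed the product.\<close>
    have "x * y < 4 ^ (x * y)" by (rule power_gt_expt) simp
    also have "\<dots> \<le> 4 ^ (E * 8 ^ (x * y))"
    proof (rule power_increasing)
      have "x * y \<le> 8 ^ (x * y)" by (rule less_imp_le, rule power_gt_expt) simp
      also have "\<dots> \<le> E * 8 ^ (x * y)" using E by simp
      finally show "x * y \<le> E * 8 ^ (x * y)" .
    qed simp
    finally have "\<not> 4 ^ (E * 8 ^ (x * y)) \<le> x * y" by (simp add: not_le)
    with start obtain k where k: "4 ^ (E * 8 ^ k) \<le> x * y" "\<not> 4 ^ (E * 8 ^ Suc k) \<le> x * y"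
      using last_true[of "\<lambda>k. 4 ^ (E * 8 ^ k) \<le> x * y"] by blast
    define e where "e = E * 8 ^ k"
    have e: "1 \<le> e" using E by (simp add: e_def)
    have xye: "4 ^ e \<le> x * y" "x * y < 4 ^ (8 * e)"
      using k unfolding e_def by (simp_all add: not_le algebra_simps)
    obtain R where R: "w \<in> cell (64 * e) R" "R \<notin> bad_cells e" using avoid[of k] unfolding e_def by blast
    define m where "m = real (x * y)"
    have "real (4 ^ e) \<le> real (x * y)" using xye(1) by (simp only: of_nat_le_iff)
    then have m4: "4 ^ e \<le> m" unfolding m_def by simp
    have "(4::real) ^ 1 \<le> 4 ^ e" by (rule power_increasing) (use e in auto)
    then have m: "4 \<le> m" using m4 by simp
    have "1 / (2 ^ 17 * m * (real e)\<^sup>2) \<le> \<bar>x * fst w + y * snd w - of_int p\<bar>" for p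
    proof (rule ccontr)
      assume "\<not> ?thesis"
      then have "R \<in> bad_cells e" unfolding bad_cells_def m_def not_le using R(1) xy(1,2) xye by blast
      then show False using R(2) by simp
    qed
    then have "1 / (2 ^ 17 * m * (real e)\<^sup>2) \<le> nint_dist (x * fst w + y * snd w)"
      unfolding nint_dist_def .
    then have "m * (1 / (2 ^ 17 * m * (real e)\<^sup>2)) * (real e)\<^sup>2 \<le> m * nint_dist (x * fst w + y * snd w) * (ln m)\<^sup>2"
    proof (intro mult_mono power_mono)
      have "real e \<le> real e * ln 4"
      proof -
        have "(1::real) \<le> ln 4"
          using ln2_ge_two_thirds ln_realpow[of 2 2] by simp
        then show ?thesis using mult_left_mono[of 1 "ln 4" "real e"] by simp
      qed
      also have "\<dots> = ln (4 ^ e)" by (simp add: ln_realpow)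
      also have "\<dots> \<le> ln m" using m4 m by (subst ln_le_cancel_iff) auto
      finally show "real e \<le> ln m" .
    qed (use m in \<open>auto simp: nint_dist_def\<close>)
    moreover have "m * (1 / (2 ^ 17 * m * (real e)\<^sup>2)) * (real e)\<^sup>2 = 1 / 2 ^ 17" using m e by simp
    moreover have "max 2 (real (x * y)) = m" using m unfolding m_def by simp
    ultimately show ?thesis by simp
  qed
  then show ?thesis
    unfolding littlewood_log_set_def case_prod_beta mem_Collect_eq
    by (intro exI[of _ "1 / 2 ^ 17"] exI[of _ "4 ^ E"] conjI allI impI) auto
qed

context thin_cover
begin

text \<open>Dependent choice iterates \<open>good_child\<close>. The common point of the nested
  squares avoids every block of strips two levels after the block starts, and every
  \<open>U i\<close> at the level where the side drops to \<open>d i\<close> or below.\<close>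

lemma uncovered_point:
  assumes E: "1 \<le> E" "1 \<le> E * (2 - s)" and sum: "(\<Sum>i. (2 ^ E * d i) powr s) \<le> 1 / 128"
  shows "\<exists>w\<in>littlewood_log_set. \<forall>i. w \<notin> U i"
proof -
  define lev where "lev k = E * 8 ^ k" for k
  \<comment> \<open>The strips of block \<open>j\<close> are resolved only at level \<open>lev (j + 2)\<close>, hence the shift.\<close>
  define B where "B k = (case k of 0 \<Rightarrow> {} | Suc j \<Rightarrow> bad_cells (lev j))" for k
  \<comment> \<open>\<open>P\<close> is the invariant of a chosen square and \<open>S\<close> what a
    step achieves. The first part of \<open>P\<close> says that the strips resolved in the next step
    spoil at most a quarter of the subsquares.\<close>
  define P where "P k Q \<longleftrightarrow> card (subcells (lev k) (lev (Suc k)) Q \<inter> B k) \<le> 4 ^ (7 * lev k) / (4::real)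
      \<and> weight (lev k) Q \<le> 1 / 128" for k Q
  define S where "S k Q R \<longleftrightarrow> R \<in> subcells (lev k) (lev (Suc k)) Q \<and> R \<notin> B k
      \<and> (\<forall>i. 1 / 2 ^ lev (Suc k) \<le> d i \<longrightarrow> d i < 1 / 2 ^ lev k \<longrightarrow> U i \<inter> cell (lev (Suc k)) R = {})" for k Q R
  have lev_Suc: "lev (Suc k) = 8 * lev k" for k by (simp add: lev_def)
  have lev1: "E \<le> lev k" for k by (simp add: lev_def)
  have lev_s: "1 \<le> lev k * (2 - s)" for k
  proof -
    have "real E * (2 - s) \<le> lev k * (2 - s)" using lev1[of k] s_less by (intro mult_right_mono) auto
    then show ?thesis using E by linarith
  qed
  have "weight E (0, 0) \<le> (\<Sum>i. (2 ^ E * d i) powr s)"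
    unfolding weight_def
    by (intro suminf_le summable_weight_term summable_scaled) (simp add: weight_term_def)
  then have "P 0 (0, 0)" unfolding P_def using sum by (simp add: B_def lev_def)
  moreover have "\<exists>R. P (Suc k) R \<and> S k Q R" if Q: "P k Q" for k Q
  proof -
    obtain R where R: "R \<in> subcells (lev k) (8 * lev k) Q" "R \<notin> B k"
      "card (subcells (8 * lev k) (64 * lev k) R \<inter> bad_cells (lev k)) \<le> 4 ^ (56 * lev k) / (4::real)"
      "suminf (child_term (lev k) R) < 1 / 128"
      using good_child[of "lev k" Q "B k"] Q lev_s lev1[of k] E unfolding P_def lev_Suc by auto
    \<comment> \<open>Because \<open>64 * lev k = lev (k + 2)\<close> and
      \<open>56 * lev k = 7 * lev (k + 1)\<close>, the count from \<open>good_child\<close> is the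
      quarter required at the next level.\<close>
    have "P (Suc k) R"
      unfolding P_def using R(3) light_child(1)[OF R(4)] by (simp add: lev_Suc B_def)
    moreover have "S k Q R"
      unfolding S_def using R(1,2) light_child(2)[OF R(4)] by (simp add: lev_Suc)
    ultimately show ?thesis by blast
  qed
  ultimately obtain q where q: "P k (q k)" "S k (q k) (q (Suc k))" for k
    using dependent_nat_choice[of P S] by metis
  have nest: "cell (lev (Suc k)) (q (Suc k)) \<subseteq> cell (lev k) (q k)" for k
    by (rule cell_subset) (use q(2)[of k] in \<open>auto simp: S_def lev_Suc\<close>)
  have "(\<Inter>k. cell (lev k) (q k)) \<noteq> {}"
  proof (rule compact_nest)
    show "cell (lev n) (q n) \<subseteq> cell (lev m) (q m)" if "m \<le> n" for m n
      using lift_Suc_antimono_le[of "\<lambda>k. cell (lev k) (q k)", OF nest that] .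
  qed (simp_all add: compact_cell cell_nonempty)
  then obtain w where w: "w \<in> cell (lev k) (q k)" for k by blast
  have "w \<in> littlewood_log_set"
  proof (rule littlewood_log_setI[OF E(1)])
    fix k
    have "w \<in> cell (64 * lev k) (q (Suc (Suc k)))" using w[of "Suc (Suc k)"] by (simp add: lev_Suc)
    moreover have "q (Suc (Suc k)) \<notin> bad_cells (lev k)" using q(2)[of "Suc k"] by (simp add: S_def B_def)
    ultimately show "\<exists>R. w \<in> cell (64 * (E * 8 ^ k)) R \<and> R \<notin> bad_cells (E * 8 ^ k)"
      unfolding lev_def by blast
  qed
  moreover have "w \<notin> U i" for i
  proof
    assume wU: "w \<in> U i"
    \<comment> \<open>No single term can reach 1, so every \<open>d i\<close> is below the side of
      the initial square and some later step has to deal with \<open>U i\<close>.\<close>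
    have "sum (\<lambda>i. (2 ^ E * d i) powr s) {i} \<le> (\<Sum>i. (2 ^ E * d i) powr s)"
      by (rule sum_le_suminf[OF summable_scaled]) auto
    then have "(2 ^ E * d i) powr s < 1" using sum by simp
    then have "2 ^ E * d i < 1"
      using s_pos ge_one_powr_ge_zero[of "2 ^ E * d i" s] by linarith
    then have "d i < 1 / 2 ^ lev 0" by (simp add: lev_def field_simps)
    moreover obtain n where "(1 / 2) ^ n < d i" using real_arch_pow_inv[OF d_pos, of "1 / 2"] by auto
    then have "1 / 2 ^ lev n \<le> d i"
    proof -
      have "n \<le> 8 ^ n" by (rule less_imp_le, rule power_gt_expt) simp
      also have "\<dots> \<le> lev n" using E by (simp add: lev_def)
      finally have "(1 / 2) ^ lev n \<le> ((1 / 2) ^ n :: real)" by (rule power_decreasing) auto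
      then show ?thesis using \<open>(1 / 2) ^ n < d i\<close> by (simp add: power_divide)
    qed
    then have "\<not> d i < 1 / 2 ^ lev n" by simp
    ultimately obtain k where "d i < 1 / 2 ^ lev k" "\<not> d i < 1 / 2 ^ lev (Suc k)"
      using last_true[of "\<lambda>k. d i < 1 / 2 ^ lev k"] by blast
    then have "U i \<inter> cell (lev (Suc k)) (q (Suc k)) = {}"
      using q(2)[of k] unfolding S_def by (simp add: not_less)
    then show False using w[of "Suc k"] wU by blast
  qed
  ultimately show ?thesis by blast
qed

end

section \<open>Hausdorff measure in the plane\<close>

lemma cell_diameter: "bounded (cell e Q)" "diameter (cell e Q) \<le> 2 / 2 ^ e"
proof -
  show "bounded (cell e Q)" by (rule compact_imp_bounded[OF compact_cell])
  show "diameter (cell e Q) \<le> 2 / 2 ^ e"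
  proof (rule diameter_le)
    fix p q assume pq: "p \<in> cell e Q" "q \<in> cell e Q"
    have one: "\<bar>u - v\<bar> \<le> 1 / 2 ^ e"
      if "u \<in> {of_int a / 2 ^ e .. (of_int a + 1) / 2 ^ e}" "v \<in> {of_int a / 2 ^ e .. (of_int a + 1) / 2 ^ e}"
      for u v :: real and a :: int
      using that by (auto simp: add_divide_distrib abs_le_iff)
    have "norm (p - q) \<le> \<bar>fst p - fst q\<bar> + \<bar>snd p - snd q\<bar>"
      using norm_Pair_le[of "fst p - fst q" "snd p - snd q"]
      by (simp add: minus_prod_def)
    also have "\<dots> \<le> 1 / 2 ^ e + 1 / 2 ^ e"
      using pq by (intro add_mono one[of _ "fst Q"] one[of _ "snd Q"]) (auto simp: cell_def)
    finally show "norm (p - q) \<le> 2 / 2 ^ e" by simp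
  qed (simp add: cell_nonempty)
qed

lemma mem_floor_cell: "w \<in> cell e (\<lfloor>2 ^ e * fst w\<rfloor>, \<lfloor>2 ^ e * snd w\<rfloor>)"
proof -
  have "of_int \<lfloor>2 ^ e * u\<rfloor> / 2 ^ e \<le> u \<and> u \<le> (of_int \<lfloor>2 ^ e * u\<rfloor> + 1) / 2 ^ e" for u :: real
    by (simp add: divide_le_eq le_divide_eq mult.commute[of u] real_of_int_floor_add_one_ge)
  then show ?thesis by (cases w) (simp add: cell_def)
qed

lemma floor_mem_subcells:
  fixes w :: "real \<times> real"
  shows "(\<lfloor>2 ^ e * fst w\<rfloor>, \<lfloor>2 ^ e * snd w\<rfloor>) \<in> subcells 0 e (\<lfloor>fst w\<rfloor>, \<lfloor>snd w\<rfloor>)"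
proof -
  have "\<lfloor>u\<rfloor> * 2 ^ e \<le> \<lfloor>2 ^ e * u\<rfloor> \<and> \<lfloor>2 ^ e * u\<rfloor> < (\<lfloor>u\<rfloor> + 1) * 2 ^ e" for u :: real
    by (simp add: le_floor_iff floor_less_iff mult.commute[of u])
  then show ?thesis by (simp add: subcells_def)
qed

text \<open>The cost of \<open>4 ^ e\<close> squares equals
  \<open>2 powr s * (2 powr (2 - s)) ^ e\<close>, a geometric sequence with ratio below 1.\<close>

lemma dyadic_cost_small:
  fixes s \<delta> \<eta> :: real
  assumes "2 < s" "0 < \<delta>" "0 < \<eta>"
  shows "\<exists>e::nat. 2 / 2 ^ e \<le> \<delta> \<and> 4 ^ e * (2 / 2 ^ e) powr s \<le> \<eta>"
proof -
  have "(\<lambda>e. 2 * (1 / 2) ^ e :: real) \<longlonglongrightarrow> 2 * 0"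
    by (intro tendsto_mult tendsto_const LIMSEQ_realpow_zero) auto
  then have 1: "\<forall>\<^sub>F e in sequentially. 2 * (1 / 2) ^ e < \<delta>"
    using assms by (intro order_tendstoD) auto
  have "2 powr (2 - s) < 2 powr 0" using assms by (intro powr_less_mono) auto
  then have "(\<lambda>e. 2 powr s * (2 powr (2 - s)) ^ e) \<longlonglongrightarrow> 2 powr s * 0"
    by (intro tendsto_mult tendsto_const LIMSEQ_realpow_zero) auto
  then have 2: "\<forall>\<^sub>F e in sequentially. 2 powr s * (2 powr (2 - s)) ^ e < \<eta>"
    using assms by (intro order_tendstoD) auto
  obtain e where e: "2 * (1 / 2) ^ e < \<delta>" "2 powr s * (2 powr (2 - s)) ^ e < \<eta>"
    using eventually_happens'[OF _ eventually_conj[OF 1 2]] by auto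
  have "(2::real) powr (2 * real e) = 4 ^ e" by (simp add: powr_realpow flip: powr_powr)
  moreover have "(2::real) powr (1 - real e) = 2 / 2 ^ e" by (simp add: powr_diff powr_realpow)
  ultimately have "4 ^ e * (2 / 2 ^ e) powr s = 2 powr (2 * real e) * (2 powr (1 - real e)) powr s" by simp
  also have "\<dots> = 2 powr (s + (2 - s) * e)"
    unfolding powr_powr powr_add[symmetric] by (simp add: algebra_simps)
  also have "\<dots> = 2 powr s * (2 powr (2 - s)) ^ e"
    by (simp add: powr_add powr_realpow[symmetric] powr_powr)
  finally show ?thesis using e by (intro exI[of _ e]) (simp add: power_divide)
qed

text \<open>The whole plane is covered: the unit square number \<open>m\<close> is divided so finely
  that its pieces cost at most \<open>\<eta> / 2 ^ (m + 1)\<close> together.\<close>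

lemma hausdorff_measure_plane_eq_0:
  fixes A :: "(real \<times> real) set"
  assumes s: "2 < s"
  shows "hausdorff_measure s A = 0"
proof -
  have "hausdorff_pre s \<delta> A \<le> 0" if \<delta>: "0 < \<delta>" for \<delta>
  proof (rule ennreal_le_epsilon)
    fix \<eta> :: real assume \<eta>: "0 < \<eta>"
    have "\<exists>e::nat. 2 / 2 ^ e \<le> \<delta> \<and> 4 ^ e * (2 / 2 ^ e) powr s \<le> \<eta> * (1 / 2) ^ Suc m" for m
      by (rule dyadic_cost_small[OF s \<delta>]) (use \<eta> in simp)
    then obtain f :: "nat \<Rightarrow> nat" where f: "2 / 2 ^ f m \<le> \<delta>" "4 ^ f m * (2 / 2 ^ f m) powr s \<le> \<eta> * (1 / 2) ^ Suc m" for m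
      by metis
    have "\<exists>h. bij_betw h {0..<4 ^ f m :: nat} (subcells 0 (f m) (from_nat m))" for m
      using ex_bij_betw_nat_finite[OF finite_subcells, of 0 "f m" "from_nat m"] by (simp add: card_subcells)
    then obtain h where h: "bij_betw (h m) {0..<4 ^ f m :: nat} (subcells 0 (f m) (from_nat m))" for m
      by metis
    \<comment> \<open>Empty sets, which cost nothing, pad each finite family to a sequence, so that
      pairs can be enumerated by \<open>prod_decode\<close>.\<close>
    define V where "V = (\<lambda>(m, l). if l < 4 ^ f m then cell (f m) (h m l) else {})"
    have "w \<in> (\<Union>i. V (prod_decode i))" for w
    proof -
      define m where "m = to_nat (\<lfloor>fst w\<rfloor>, \<lfloor>snd w\<rfloor>)"
      have "(\<lfloor>2 ^ f m * fst w\<rfloor>, \<lfloor>2 ^ f m * snd w\<rfloor>) \<in> h m ` {0..<4 ^ f m}"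
        using floor_mem_subcells[of "f m" w] h[of m] by (simp add: bij_betw_def m_def)
      then obtain l where "l < 4 ^ f m" "h m l = (\<lfloor>2 ^ f m * fst w\<rfloor>, \<lfloor>2 ^ f m * snd w\<rfloor>)" by auto
      then have "w \<in> V (prod_decode (prod_encode (m, l)))"
        using mem_floor_cell[of w "f m"] by (simp add: V_def)
      then show ?thesis by blast
    qed
    moreover have "bounded (V z) \<and> diameter (V z) \<le> \<delta>" for z
      using cell_diameter[of "f (fst z)" "h (fst z) (snd z)"] f(1)[of "fst z"] \<delta>
      by (cases z) (auto simp: V_def intro: order_trans)
    ultimately have "hausdorff_pre s \<delta> A \<le> (\<Sum>i. hcost s (V (prod_decode i)))"
      unfolding hausdorff_pre_def by (intro INF_lower) auto
    also have "\<dots> = (\<Sum>m. \<Sum>l. hcost s (V (m, l)))"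
      by (rule suminf_ennreal_2dimen) simp
    also have "\<dots> \<le> (\<Sum>m. ennreal (\<eta> * (1 / 2) ^ Suc m))"
    proof (intro suminf_le allI)
      fix m
      have "(\<Sum>l. hcost s (V (m, l))) = (\<Sum>l<4 ^ f m. hcost s (V (m, l)))"
        by (rule suminf_finite) (auto simp: V_def hcost_def)
      also have "\<dots> \<le> (\<Sum>l<(4::nat) ^ f m. ennreal ((2 / 2 ^ f m) powr s))"
      proof (rule sum_mono)
        fix l :: nat assume "l \<in> {..<4 ^ f m}"
        then have V: "V (m, l) = cell (f m) (h m l)" by (simp add: V_def)
        show "hcost s (V (m, l)) \<le> ennreal ((2 / 2 ^ f m) powr s)"
          unfolding V using s cell_diameter[of "f m" "h m l"]
          by (auto simp: hcost_def intro!: ennreal_leI powr_mono2 diameter_ge_0)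
      qed
      also have "\<dots> = ennreal (4 ^ f m * (2 / 2 ^ f m) powr s)"
        by (simp add: ennreal_mult ennreal_of_nat_eq_real_of_nat flip: ennreal_power)
      also have "\<dots> \<le> ennreal (\<eta> * (1 / 2) ^ Suc m)" by (rule ennreal_leI) (rule f)
      finally show "(\<Sum>l. hcost s (V (m, l))) \<le> ennreal (\<eta> * (1 / 2) ^ Suc m)" .
    qed auto
    also have "\<dots> = ennreal \<eta>"
      using sums_mult[OF power_half_series, of \<eta>] \<eta> by (intro sums_unique[symmetric]) (simp add: sums_ennreal)
    finally show "hausdorff_pre s \<delta> A \<le> 0 + ennreal \<eta>" by simp
  qed
  then show ?thesis unfolding hausdorff_measure_def by (intro antisym SUP_least) auto
qed

section \<open>Lower bound for the dimension\<close>

text \<open>Passing to the exponent \<open>max s 1\<close> keeps it below 2 and removes the special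
  case \<open>s = 0\<close>. As the diameters are at most 1, the larger exponent does not increase
  the cost.\<close>

lemma null_set_thin_cover:
  fixes A :: "(real \<times> real) set" and s \<eta> :: real
  assumes null: "hausdorff_measure s A = 0" and s: "0 \<le> s" "s < 2" and \<eta>: "0 < \<eta>"
  shows "\<exists>U d. A \<subseteq> (\<Union>i. U i) \<and> thin_cover U d (max s 1) \<and> (\<Sum>i. d i powr max s 1) \<le> \<eta>"
proof -
  define r where "r = max s 1"
  have r: "0 < r" "1 \<le> r" "s \<le> r" "r < 2" using s by (auto simp: r_def)
  have "hausdorff_pre s 1 A \<le> hausdorff_measure s A"
    unfolding hausdorff_measure_def by (rule SUP_upper) simp
  then have "hausdorff_pre s 1 A < ennreal (\<eta> / 2)" using null \<eta> by (simp add: le_less_trans)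
  then obtain U where U: "A \<subseteq> (\<Union>i. U i)" "\<And>i. bounded (U i)" "\<And>i. diameter (U i) \<le> 1"
    and cost: "(\<Sum>i. hcost s (U i)) < ennreal (\<eta> / 2)"
    unfolding hausdorff_pre_def INF_less_iff by blast
  define a where "a i = diameter (U i)" for i
  \<comment> \<open>The numbers \<open>b i\<close> make the \<open>d i\<close> positive at a total
    cost of \<open>\<eta> / 2\<close>, the other half being left for the diameters.\<close>
  define b where "b i = (\<eta> / 2 * (1 / 2) ^ Suc i) powr (1 / r)" for i
  define d where "d i = max (a i) (b i)" for i
  have a: "0 \<le> a i" "a i \<le> 1" for i using U diameter_ge_0 by (auto simp: a_def)
  have b: "0 < b i" "b i powr r = \<eta> / 2 * (1 / 2) ^ Suc i" for i
    using \<eta> r by (auto simp: b_def powr_powr)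
  have "ennreal (a i powr r) \<le> hcost s (U i)" for i
  proof (cases "U i = {} \<or> a i = 0")
    case True
    then show ?thesis using r by (auto simp: a_def)
  next
    case False
    have "a i powr r \<le> a i powr s" using a[of i] r by (intro powr_mono') auto
    moreover have "a i powr r \<le> 1" using a[of i] r by (intro powr_le1) auto
    ultimately show ?thesis using False by (auto simp: hcost_def a_def intro: ennreal_leI)
  qed
  then have "(\<Sum>i. ennreal (a i powr r)) \<le> (\<Sum>i. hcost s (U i))" by (intro suminf_le) auto
  then have sum_a: "(\<Sum>i. ennreal (a i powr r)) < ennreal (\<eta> / 2)" using cost by (rule le_less_trans)
  then have summ_a: "summable (\<lambda>i. a i powr r)"
    by (intro summable_suminf_not_top) (auto simp: less_top[symmetric])
  then have a_sum: "(\<Sum>i. a i powr r) \<le> \<eta> / 2"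
    using sum_a \<eta> by (subst (asm) suminf_ennreal2) (auto simp: ennreal_less_iff suminf_nonneg)
  have b_sums: "(\<lambda>i. b i powr r) sums (\<eta> / 2)"
    unfolding b(2) using sums_mult[OF power_half_series, of "\<eta> / 2"] by simp
  have d_le: "d i powr r \<le> a i powr r + b i powr r" for i by (auto simp: d_def max_def)
  have summ_ab: "summable (\<lambda>i. a i powr r + b i powr r)"
    using summ_a sums_summable[OF b_sums] by (rule summable_add)
  have summ_d: "summable (\<lambda>i. d i powr r)"
    by (rule summable_comparison_test'[OF summ_ab, of 0]) (use d_le in auto)
  have "(\<Sum>i. d i powr r) \<le> (\<Sum>i. a i powr r + b i powr r)"
    by (rule suminf_le[OF d_le summ_d summ_ab])
  also have "\<dots> = (\<Sum>i. a i powr r) + \<eta> / 2"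
    using suminf_add[OF summ_a sums_summable[OF b_sums]] sums_unique[OF b_sums] by simp
  finally have "(\<Sum>i. d i powr r) \<le> \<eta>" using a_sum by linarith
  moreover have "thin_cover U d r"
  proof
    show "dist p q \<le> d i" if "p \<in> U i" "q \<in> U i" for p q i
      using diameter_bounded_bound[OF U(2) that] by (simp add: d_def a_def)
    show "0 < d i" for i using b(1)[of i] by (simp add: d_def)
  qed (use r summ_d in auto)
  ultimately show ?thesis unfolding r_def[symmetric] using U(1) by (intro exI[of _ U] exI[of _ d]) auto
qed

lemma hausdorff_measure_littlewood_log_set_neq_0:
  assumes "0 \<le> s" "s < 2"
  shows "hausdorff_measure s littlewood_log_set \<noteq> 0"
proof
  assume null: "hausdorff_measure s littlewood_log_set = 0"
  define r where "r = max s 1"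
  have r: "0 < 2 - r" using assms by (simp add: r_def)
  \<comment> \<open>The initial level must be large when \<open>r\<close> is close to 2, so that
    \<open>E * (2 - r)\<close> is at least 1.\<close>
  obtain E :: nat where E: "1 / (2 - r) < E" using reals_Archimedean2 by blast
  have "0 < 1 / (2 - r)" using r by simp
  then have E1: "1 \<le> E" using E by linarith
  have E2: "1 \<le> E * (2 - r)" using E r by (simp add: field_simps)
  \<comment> \<open>Rescaling by the initial side multiplies the cost by
    \<open>(2 ^ E) powr r\<close>, and the result has to be the threshold
    \<open>1 / 128\<close>.\<close>
  define \<eta> where "\<eta> = 1 / (128 * (2 ^ E) powr r)"
  have "0 < \<eta>" by (simp add: \<eta>_def)
  then obtain U d where U: "littlewood_log_set \<subseteq> (\<Union>i. U i)" "thin_cover U d r"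
    "(\<Sum>i. d i powr r) \<le> \<eta>"
    using null_set_thin_cover[OF null assms] unfolding r_def[symmetric] by blast
  interpret thin_cover U d r by (rule U)
  have "(\<Sum>i. (2 ^ E * d i) powr r) = (\<Sum>i. (2 ^ E) powr r * d i powr r)"
    using d_pos by (simp add: powr_mult less_imp_le)
  also have "\<dots> = (2 ^ E) powr r * (\<Sum>i. d i powr r)"
    by (rule suminf_mult[OF summable_d])
  also have "\<dots> \<le> (2 ^ E) powr r * \<eta>" using U(3) by (rule mult_left_mono) simp
  also have "\<dots> = 1 / 128" by (simp add: \<eta>_def)
  finally obtain w where "w \<in> littlewood_log_set" "\<forall>i. w \<notin> U i"
    using uncovered_point[OF E1 E2] by blast
  then show False using U(1) by blast
qed

theorem theorem4:
  shows "hausdorff_dim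
    {(\<alpha>::real, \<beta>::real). \<exists>c>0. \<exists>N::int. \<forall>x y :: nat. 0 < x \<longrightarrow> 0 < y \<longrightarrow> N \<le> int (x * y) \<longrightarrow>
        max 2 (real (x * y)) * nint_dist (real x * \<alpha> + real y * \<beta>) * (ln (max 2 (real (x * y))))\<^sup>2 \<ge> c}
    = 2"
proof -
  have "hausdorff_dim littlewood_log_set = 2"
  proof (rule antisym)
    show "hausdorff_dim littlewood_log_set \<le> 2"
    proof (rule ccontr)
      assume "\<not> ?thesis"
      then obtain s where s: "2 < ereal s" "ereal s < hausdorff_dim littlewood_log_set"
        using ereal_dense2[of 2] by (auto simp: not_le)
      have "hausdorff_dim littlewood_log_set \<le> ereal s"
        unfolding hausdorff_dim_def using s(1)
        by (intro INF_lower) (simp add: hausdorff_measure_plane_eq_0)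
      then show False using s(2) by simp
    qed
    show "2 \<le> hausdorff_dim littlewood_log_set"
      unfolding hausdorff_dim_def
    proof (rule INF_greatest)
      fix s assume "s \<in> {s. 0 \<le> s \<and> hausdorff_measure s littlewood_log_set = 0}"
      then have "2 \<le> s" using hausdorff_measure_littlewood_log_set_neq_0[of s] by force
      then show "2 \<le> ereal s" by simp
    qed
  qed
  then show ?thesis unfolding littlewood_log_set_def .
qed

end
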